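(* Let $Q\ge 2$ be an integer and let $q,\rho,v,K$ be complex numbers with $q\neq 0$ satisfying $$-q\rho=Q^{-1/2}v,\qquad q+q^{-1}=Q^{1/2},\qquad v=e^{K}-1 .$$ Suppose $\rho=1$. Then, for one of the choices of sign, $$e^{K}=\frac{2-Q\mp\sqrt{Q}\sqrt{Q-4}}{2}.$$ In particular: if $Q=2$ then $e^{K}=\pm i$; if $Q=3$ then $e^{K}=\frac{-1\pm\sqrt{3}\,i}{2}$; if $Q=4$ then $e^{K}=-1$; and if $Q>4$ then $e^{K}$ is real and negative. Thus in all cases $K$ is not a real number.
   Context: The $Q$-state Potts partition function of a finite graph $G$ is $P_G=\sum_\sigma e^{K E(\sigma)}$, where $\sigma$ runs over assignments of elements of $\{1,\dots,Q\}$ to the nodes of $G$, $E(\sigma)$ is the number of edges whose end-nodes receive the same assignment, and $K=J/(kT)$ ($J=\pm1$, $k$ Boltzmann's constant, $T$ temperature). The $\rho$-bracket of a link diagram is defined by the expansion, at each crossing, [diagram] $=$ [$A$-smoothing] $-\,q\rho\,$[$B$-smoothing], with each loop having value $q+q^{-1}$. The displayed relations between $(q,\rho)$ and $(Q,v)$ are those under which the $\rho$-bracket specializes to the bracket expansion of the Potts model, in which the $B$-smoothing has coefficient $Q^{-1/2}v$ and loops have value $Q^{1/2}$. When $\rho=1$ the $\rho$-bracket is the Khovanov form of the bracket polynomial. Here $\sqrt{Q-4}$ denotes a (possibly imaginary) complex square root. *)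

theory Defs
  imports Complex_Main
begin

end

theory Submission
  imports Defs
begin

text \<open>
  Put \<open>E = e\<^sup>K\<close> and \<open>s = \<surd>Q\<close>. At \<open>\<rho> = 1\<close> the coefficient relation says \<open>E = 1 - s q\<close>,
  and the loop value gives \<open>q\<^sup>2 = s q - 1\<close>. Substituting \<open>s q = 1 - E\<close> in the second relation
  eliminates \<open>q\<close> and leaves the reciprocal quadratic \<open>E\<^sup>2 + (Q - 2) E + 1 = 0\<close>
  (\<open>exp_quadratic\<close>), whose discriminant is \<open>Q (Q - 4)\<close>. All the explicit values of \<open>E\<close> are read
  off from it by completing the square.

  The sign and non-reality claims need no case distinction on \<open>Q\<close>: since \<open>Q \<ge> 2\<close>, every
  coefficient of the quadratic is nonnegative and its constant term is positive, so a real root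
  must be negative (\<open>real_root_negative\<close>). A real \<open>K\<close> would make \<open>E\<close> a positive real root.
\<close>

lemma exp_quadratic:
  fixes q s E :: complex
  assumes "s \<noteq> 0" "q \<noteq> 0" and coeff: "- q = (E - 1) / s" and loop: "q + inverse q = s"
  shows "E\<^sup>2 + (s\<^sup>2 - 2) * E + 1 = 0"
proof -
  have sq: "s * q = 1 - E"
    using coeff \<open>s \<noteq> 0\<close> by (simp add: field_simps)
  have "q\<^sup>2 = s * q - 1"
    using loop \<open>q \<noteq> 0\<close> by (auto simp: field_simps power2_eq_square)
  then have "(s * q)\<^sup>2 = s\<^sup>2 * (s * q - 1)"
    by (simp add: power_mult_distrib)
  then show ?thesis
    unfolding sq by (simp add: algebra_simps power2_eq_square)
qed

text \<open>Completing the square, with any square root \<open>d\<close> of the discriminant.\<close>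
lemma quadratic_roots:
  fixes E b d :: complex
  assumes root: "E\<^sup>2 + b * E + 1 = 0" and discriminant: "d\<^sup>2 = b\<^sup>2 - 4"
  shows "E = (- b - d) / 2 \<or> E = (- b + d) / 2"
proof -
  have "(2 * E + b)\<^sup>2 = 4 * (E\<^sup>2 + b * E + 1) + (b\<^sup>2 - 4)"
    by (simp add: algebra_simps power2_eq_square)
  then have "(2 * E + b)\<^sup>2 = d\<^sup>2"
    by (simp add: root discriminant)
  then have "2 * E + b = d \<or> 2 * E + b = - d"
    by (simp add: power2_eq_iff)
  then show ?thesis
    by (auto simp: field_simps eq_neg_iff_add_eq_0)
qed

lemma real_root_negative:
  fixes x b :: real
  assumes "x\<^sup>2 + b * x + 1 = 0" "b \<ge> 0"
  shows "x < 0"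
proof (rule ccontr)
  assume "\<not> x < 0"
  then have "b * x \<ge> 0"
    using \<open>b \<ge> 0\<close> by simp
  then show False
    using assms(1) zero_le_power2[of x] by linarith
qed

theorem mainTheorem3:
  fixes Q :: nat and q \<rho> v K :: complex
  assumes "Q \<ge> 2"
    and "q \<noteq> 0"
    and "- q * \<rho> = complex_of_real (real Q powr (- 1 / 2)) * v"
    and "q + inverse q = complex_of_real (real Q powr (1 / 2))"
    and "v = exp K - 1"
    and "\<rho> = 1"
  shows "(exp K = (2 - of_nat Q - complex_of_real (sqrt (real Q)) * csqrt (of_nat Q - 4)) / 2
          \<or> exp K = (2 - of_nat Q + complex_of_real (sqrt (real Q)) * csqrt (of_nat Q - 4)) / 2)
    \<and> (Q = 2 \<longrightarrow> exp K = \<i> \<or> exp K = - \<i>)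
    \<and> (Q = 3 \<longrightarrow> exp K = (- 1 + complex_of_real (sqrt 3) * \<i>) / 2
                 \<or> exp K = (- 1 - complex_of_real (sqrt 3) * \<i>) / 2)
    \<and> (Q = 4 \<longrightarrow> exp K = - 1)
    \<and> (Q > 4 \<longrightarrow> exp K \<in> \<real> \<and> Re (exp K) < 0)
    \<and> K \<notin> \<real>"
proof -
  define E where "E = exp K"
  define s where "s = complex_of_real (sqrt (real Q))"
  define d where "d = s * csqrt (of_nat Q - 4)"
  have s2: "s\<^sup>2 = of_nat Q"
    unfolding s_def by (simp flip: of_real_power)
  have "s \<noteq> 0"
    using assms(1) by (simp add: s_def)
  have "- q = (E - 1) / s"
    using assms(1,3,5,6) by (simp add: E_def s_def powr_minus powr_half_sqrt field_simps)
  moreover have "q + inverse q = s"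
    using assms(4) by (simp add: s_def powr_half_sqrt)
  ultimately have quad: "E\<^sup>2 + (of_nat Q - 2) * E + 1 = 0"
    using exp_quadratic[OF \<open>s \<noteq> 0\<close> assms(2)] by (simp add: s2)
  have roots: "E = (2 - of_nat Q - e) / 2 \<or> E = (2 - of_nat Q + e) / 2"
    if "e\<^sup>2 = of_nat Q * (of_nat Q - 4)" for e
    using quadratic_roots[OF quad, of e] that by (simp add: algebra_simps power2_eq_square)
  have "d\<^sup>2 = of_nat Q * (of_nat Q - 4)"
    by (simp add: d_def power_mult_distrib s2)
  note general = roots[OF this]
  have neg: "Re E < 0" if "E \<in> \<real>"
  proof -
    from that obtain x where x: "E = of_real x"
      by (rule Reals_cases)
    have "complex_of_real (x\<^sup>2 + (real Q - 2) * x + 1) = 0"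
      using quad by (simp add: x)
    then have "x\<^sup>2 + (real Q - 2) * x + 1 = 0"
      by (simp only: of_real_eq_0_iff)
    then show ?thesis
      using real_root_negative[of x "real Q - 2"] assms(1) by (simp add: x)
  qed
  have Q2: "E = \<i> \<or> E = - \<i>" if "Q = 2"
    using roots[of "2 * \<i>"] that by (auto simp: power_mult_distrib)
  have Q3: "E = (- 1 + complex_of_real (sqrt 3) * \<i>) / 2
          \<or> E = (- 1 - complex_of_real (sqrt 3) * \<i>) / 2" if "Q = 3"
    using roots[of "complex_of_real (sqrt 3) * \<i>"] that
    by (auto simp: power_mult_distrib simp flip: of_real_power)
  have Q4: "E = - 1" if "Q = 4"
    using roots[of 0] that by simp
  have real_E: "E \<in> \<real>" if "Q > 4"
  proof -
    have "csqrt (of_nat Q - 4) = complex_of_real (sqrt (real Q - 4))"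
      using that csqrt_of_real_nonneg[of "of_nat Q - 4"] by simp
    then have "d \<in> \<real>"
      by (simp add: d_def s_def)
    then show ?thesis
      using general
      by (elim disjE) (simp_all only: Reals_divide Reals_add Reals_diff Reals_of_nat Reals_numeral)
  qed
  have "K \<notin> \<real>"
  proof
    assume "K \<in> \<real>"
    then obtain x where "K = of_real x"
      by (rule Reals_cases)
    then have "E = of_real (exp x)"
      by (simp add: E_def exp_of_real)
    then show False
      using neg by (simp add: not_less)
  qed
  then show ?thesis
    using general Q2 Q3 Q4 real_E neg unfolding E_def d_def s_def by blast
qed

end
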